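(* Let $R$ be a locally bounded $K$-category, $X\in\mathrm{Mod}(R)$, $M,N\in\mathrm{mod}(R)$, and let $f:M\to N$ and $\alpha:X\to N$ be $R$-homomorphisms. Suppose that $\mathrm{Im}\,\mathrm{Hom}_R( *,\alpha)\subseteq\mathrm{Im}\,\mathrm{Hom}_R( *,f)$ as subfunctors of $\mathrm{Hom}_R( *,N)$ on $\mathrm{mod}(R)$, i.e. for every $L\in\mathrm{mod}(R)$ and every $R$-homomorphism $\gamma:L\to X$ there exists $h:L\to M$ with $\alpha\gamma=fh$. Then $\alpha$ factors through $f$, i.e. $\alpha=f\beta$ for some $R$-homomorphism $\beta:X\to M$.
   Context: $K$ is an algebraically closed field. A $K$-category $R$ is locally bounded if distinct objects are non-isomorphic, endomorphism algebras of objects are local, and for each object $x$, $\sum_y\dim_K R(x,y)<\infty$ and $\sum_y\dim_K R(y,x)<\infty$. An $R$-module is a $K$-linear functor $R^{op}\to\mathrm{Mod}(K)$; $\mathrm{Mod}(R)$ consists of $R$-modules $X$ with $\dim_K X(x)<\infty$ for all objects $x$, and $\mathrm{mod}(R)$ of those with $\sum_x\dim_K M(x)<\infty$. *)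

theory Defs
  imports "Jordan_Normal_Form.Matrix" "HOL-Computational_Algebra.Polynomial"
begin

text \<open>Coordinate encoding. A K-category with finite-dimensional morphism spaces:
  objects are the elements of type 'o; the morphism space R(x,y) (morphisms x \<rightarrow> y)
  is K^(hdim x y); composition cmp x y z b a = b \<circ> a for a : x \<rightarrow> y, b : y \<rightarrow> z;
  idn x is the identity of x.\<close>

definition alg_closed :: "'k::field itself \<Rightarrow> bool" where
  "alg_closed _ \<longleftrightarrow> (\<forall>p :: 'k poly. 0 < degree p \<longrightarrow> (\<exists>z. poly p z = 0))"

record ('o,'k) kcat =
  hdim :: "'o \<Rightarrow> 'o \<Rightarrow> nat"
  cmp  :: "'o \<Rightarrow> 'o \<Rightarrow> 'o \<Rightarrow> 'k vec \<Rightarrow> 'k vec \<Rightarrow> 'k vec"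
  idn  :: "'o \<Rightarrow> 'k vec"

definition Hom :: "('o,'k) kcat \<Rightarrow> 'o \<Rightarrow> 'o \<Rightarrow> 'k vec set" where
  "Hom R x y = carrier_vec (hdim R x y)"

definition is_kcat :: "('o,'k::field) kcat \<Rightarrow> bool" where
  "is_kcat R \<longleftrightarrow>
    (\<forall>x y z a b. a \<in> Hom R x y \<longrightarrow> b \<in> Hom R y z \<longrightarrow> cmp R x y z b a \<in> Hom R x z) \<and>
    (\<forall>x y z a a' b. a \<in> Hom R x y \<longrightarrow> a' \<in> Hom R x y \<longrightarrow> b \<in> Hom R y z \<longrightarrow>
        cmp R x y z b (a + a') = cmp R x y z b a + cmp R x y z b a') \<and>
    (\<forall>x y z a b b'. a \<in> Hom R x y \<longrightarrow> b \<in> Hom R y z \<longrightarrow> b' \<in> Hom R y z \<longrightarrow>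
        cmp R x y z (b + b') a = cmp R x y z b a + cmp R x y z b' a) \<and>
    (\<forall>x y z a b c. a \<in> Hom R x y \<longrightarrow> b \<in> Hom R y z \<longrightarrow>
        cmp R x y z b (c \<cdot>\<^sub>v a) = c \<cdot>\<^sub>v cmp R x y z b a \<and>
        cmp R x y z (c \<cdot>\<^sub>v b) a = c \<cdot>\<^sub>v cmp R x y z b a) \<and>
    (\<forall>w x y z a b c. a \<in> Hom R w x \<longrightarrow> b \<in> Hom R x y \<longrightarrow> c \<in> Hom R y z \<longrightarrow>
        cmp R w y z c (cmp R w x y b a) = cmp R w x z (cmp R x y z c b) a) \<and>
    (\<forall>x. idn R x \<in> Hom R x x) \<and>
    (\<forall>x y a. a \<in> Hom R x y \<longrightarrow> cmp R x y y (idn R y) a = a \<and> cmp R x x y a (idn R x) = a)"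

definition is_iso_pair :: "('o,'k) kcat \<Rightarrow> 'o \<Rightarrow> 'o \<Rightarrow> 'k vec \<Rightarrow> 'k vec \<Rightarrow> bool" where
  "is_iso_pair R x y a b \<longleftrightarrow> a \<in> Hom R x y \<and> b \<in> Hom R y x \<and>
     cmp R x y x b a = idn R x \<and> cmp R y x y a b = idn R y"

definition is_unit_end :: "('o,'k) kcat \<Rightarrow> 'o \<Rightarrow> 'k vec \<Rightarrow> bool" where
  "is_unit_end R x u \<longleftrightarrow> (\<exists>v. is_iso_pair R x x u v)"

text \<open>Local algebra: 1 \<noteq> 0 and the non-units are closed under addition.\<close>
definition local_end :: "('o,'k::field) kcat \<Rightarrow> 'o \<Rightarrow> bool" where
  "local_end R x \<longleftrightarrow> idn R x \<noteq> 0\<^sub>v (hdim R x x) \<and>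
     (\<forall>a \<in> Hom R x x. \<forall>b \<in> Hom R x x.
        \<not> is_unit_end R x a \<longrightarrow> \<not> is_unit_end R x b \<longrightarrow> \<not> is_unit_end R x (a + b))"

definition locally_bounded :: "('o,'k::field) kcat \<Rightarrow> bool" where
  "locally_bounded R \<longleftrightarrow> is_kcat R \<and>
     (\<forall>x y. x \<noteq> y \<longrightarrow> \<not> (\<exists>a b. is_iso_pair R x y a b)) \<and>
     (\<forall>x. local_end R x) \<and>
     (\<forall>x. finite {y. hdim R x y \<noteq> 0} \<and> finite {y. hdim R y x \<noteq> 0})"

text \<open>An R-module (contravariant K-linear functor R^op \<rightarrow> Mod K) with finite-dimensional
  values X(x) = K^(mdim x); for a : x \<rightarrow> y, mact x y a : X(y) \<rightarrow> X(x) is a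
  (mdim x) \<times> (mdim y) matrix acting on column vectors.\<close>
record ('o,'k) rmod =
  mdim :: "'o \<Rightarrow> nat"
  mact :: "'o \<Rightarrow> 'o \<Rightarrow> 'k vec \<Rightarrow> 'k mat"

text \<open>Objects of Mod(R).\<close>
definition in_Mod :: "('o,'k::field) kcat \<Rightarrow> ('o,'k) rmod \<Rightarrow> bool" where
  "in_Mod R X \<longleftrightarrow>
    (\<forall>x y a. a \<in> Hom R x y \<longrightarrow> mact X x y a \<in> carrier_mat (mdim X x) (mdim X y)) \<and>
    (\<forall>x y a a'. a \<in> Hom R x y \<longrightarrow> a' \<in> Hom R x y \<longrightarrow>
        mact X x y (a + a') = mact X x y a + mact X x y a') \<and>
    (\<forall>x y a c. a \<in> Hom R x y \<longrightarrow> mact X x y (c \<cdot>\<^sub>v a) = c \<cdot>\<^sub>m mact X x y a) \<and>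
    (\<forall>x. mact X x x (idn R x) = 1\<^sub>m (mdim X x)) \<and>
    (\<forall>x y z a b. a \<in> Hom R x y \<longrightarrow> b \<in> Hom R y z \<longrightarrow>
        mact X x z (cmp R x y z b a) = mact X x y a * mact X y z b)"

text \<open>Objects of mod(R): total dimension finite.\<close>
definition in_mod :: "('o,'k::field) kcat \<Rightarrow> ('o,'k) rmod \<Rightarrow> bool" where
  "in_mod R X \<longleftrightarrow> in_Mod R X \<and> finite {x. mdim X x \<noteq> 0}"

text \<open>R-homomorphisms X \<rightarrow> Y: families of K-linear maps f x : X(x) \<rightarrow> Y(x) (matrices)
  natural in x.\<close>
definition is_hom :: "('o,'k::field) kcat \<Rightarrow> ('o,'k) rmod \<Rightarrow> ('o,'k) rmod \<Rightarrow> ('o \<Rightarrow> 'k mat) \<Rightarrow> bool" where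
  "is_hom R X Y f \<longleftrightarrow>
    (\<forall>x. f x \<in> carrier_mat (mdim Y x) (mdim X x)) \<and>
    (\<forall>x y a. a \<in> Hom R x y \<longrightarrow> f x * mact X x y a = mact Y x y a * f y)"

end

(* Let T consist of the supports of M and N together with all objects that receive a nonzero
   morphism from the support of M; T is finite because R is locally bounded.  The submodule L
   of X generated by the spaces X(x), x in T, coincides with X on T, and L(z) = 0 unless R(z,x)
   is nonzero for some x in T, so local boundedness again puts L in mod(R).  The hypothesis,
   applied to the inclusion of L into X, gives h : L -> M with alpha = f h on T.  Extending h by
   zero outside T yields beta: it is natural because every morphism out of the support of M ends
   in T, and alpha = f beta holds outside T because N vanishes there. *)

theory Submission
  imports Defs "Jordan_Normal_Form.DL_Rank"
begin

lemma (in vec_space) subspace_eq_span_lin_indpt: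
  fixes W :: "'a vec set"
  assumes W: "W \<subseteq> carrier_vec n" and zero: "0\<^sub>v n \<in> W"
    and add: "\<And>u w. u \<in> W \<Longrightarrow> w \<in> W \<Longrightarrow> u + w \<in> W"
    and smult: "\<And>c w. w \<in> W \<Longrightarrow> c \<cdot>\<^sub>v w \<in> W"
  shows "\<exists>A. finite A \<and> A \<subseteq> W \<and> lin_indpt A \<and> W = span A"
proof -
  have "submodule class_ring W V"
    unfolding submodule_def using W zero add smult by (auto simp: vec_module)
  let ?P = "\<lambda>A. A \<subseteq> W \<and> lin_indpt A"
  have bounded: "finite A \<and> card A \<le> dim" if "?P A" for A
    using that li_le_dim W by (meson fin_dim order_trans cV)
  have "?P {}" by (simp add: lin_dep_def)
  then obtain A where "finite A" and max: "maximal A ?P"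
    using maximal_exists[of ?P dim "{}"] bounded by blast
  have AW: "A \<subseteq> W" and indpt: "lin_indpt A" using max unfolding maximal_def by auto
  have AC: "A \<subseteq> carrier_vec n" using AW W by auto
  have "span A \<subseteq> W" using span_is_subset[OF AW \<open>submodule class_ring W V\<close>] .
  moreover have "W \<subseteq> span A"
  proof
    fix w assume w: "w \<in> W"
    show "w \<in> span A"
    proof (rule ccontr)
      assume ns: "w \<notin> span A"
      have wA: "w \<notin> A" using ns span_mem AC by (metis cV)
      have "lin_indpt (A \<union> {w})" using lin_dep_iff_in_span[OF _ indpt _ wA] ns AC w W by auto
      then have "A \<union> {w} = A" using max AW w unfolding maximal_def by blast
      then show False using wA by auto
    qed
  qed
  ultimately show ?thesis using \<open>finite A\<close> AW indpt by blast
qed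

lemma (in vec_space) span_lin_indpt_eq_image_inj_mat:
  assumes "finite A" and AC: "A \<subseteq> carrier_vec n" and indpt: "lin_indpt A"
  shows "\<exists>d B. B \<in> carrier_mat n d \<and> inj_on ((*\<^sub>v) B) (carrier_vec d) \<and>
    span A = (*\<^sub>v) B ` carrier_vec d"
proof -
  obtain bs where bs: "distinct bs" "set bs = A" using finite_distinct_list[OF \<open>finite A\<close>] by blast
  define B where "B = mat_of_cols n bs"
  have B: "B \<in> carrier_mat n (length bs)" unfolding B_def by simp
  have dim_bs: "\<forall>w\<in>set bs. dim_vec w = n" using AC bs by auto
  have B_lincomb: "B *\<^sub>v v = lincomb_list (($) v) bs" if "v \<in> carrier_vec (length bs)" for v
  proof -
    have "vec (length bs) (($) v) = v" using that by auto
    then show ?thesis using lincomb_list_as_mat_mult[OF dim_bs, of "($) v"] unfolding B_def by simp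
  qed
  have "inj_on ((*\<^sub>v) B) (carrier_vec (length bs))"
  proof (rule inj_onI, rule ccontr)
    fix v w assume v: "v \<in> carrier_vec (length bs)" and w: "w \<in> carrier_vec (length bs)"
      and eq: "B *\<^sub>v v = B *\<^sub>v w" and ne: "v \<noteq> w"
    have "B *\<^sub>v (v - w) = 0\<^sub>v n" using B v w eq by (simp add: mult_minus_distrib_mat_vec)
    moreover have "v - w \<noteq> 0\<^sub>v (length bs)" using v w ne
      by (metis (no_types, lifting) ext comm_add_vec minus_add_minus_vec minus_cancel_vec
          uminus_eq_vec zero_minus_vec)
    moreover have "cols B = bs" unfolding B_def using bs AC by simp
    ultimately have "lin_dep (set (cols B))" using lin_depI[OF B, of "v - w"] v w bs by auto
    then show False using indpt \<open>cols B = bs\<close> bs by simp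
  qed
  moreover have "span A = (*\<^sub>v) B ` carrier_vec (length bs)"
  proof -
    have "span A = span_list bs" using span_list_as_span[of bs] AC bs by auto
    also have "\<dots> = (*\<^sub>v) B ` carrier_vec (length bs)"
    proof
      show "span_list bs \<subseteq> (*\<^sub>v) B ` carrier_vec (length bs)"
        unfolding span_list_def using lincomb_list_as_mat_mult[OF dim_bs] B_def by auto
      show "(*\<^sub>v) B ` carrier_vec (length bs) \<subseteq> span_list bs"
        unfolding span_list_def using B_lincomb by auto
    qed
    finally show ?thesis .
  qed
  ultimately show ?thesis using B by blast
qed

lemma subspace_eq_image_inj_mat:
  fixes W :: "'a::field vec set"
  assumes "W \<subseteq> carrier_vec n" "0\<^sub>v n \<in> W"
    "\<And>u w. u \<in> W \<Longrightarrow> w \<in> W \<Longrightarrow> u + w \<in> W"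
    "\<And>c w. w \<in> W \<Longrightarrow> c \<cdot>\<^sub>v w \<in> W"
  shows "\<exists>d B. B \<in> carrier_mat n d \<and> inj_on ((*\<^sub>v) B) (carrier_vec d) \<and> W = (*\<^sub>v) B ` carrier_vec d"
proof -
  interpret vec_space "TYPE('a)" n .
  obtain A where A: "finite A" "A \<subseteq> W" "lin_indpt A" and "W = span A"
    using subspace_eq_span_lin_indpt[OF assms] by blast
  moreover have "A \<subseteq> carrier_vec n" using A(2) assms(1) by blast
  ultimately show ?thesis using span_lin_indpt_eq_image_inj_mat[OF A(1) _ A(3)] by simp
qed

lemma col_eq_mult_unit_vec:
  fixes A :: "'a::semiring_1 mat"
  assumes "A \<in> carrier_mat n m" "j < m"
  shows "col A j = A *\<^sub>v unit_vec m j"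
proof -
  have "A * 1\<^sub>m m = A" using assms(1) by (rule right_mult_one_mat)
  then show ?thesis using col_mult2[OF assms(1) one_carrier_mat assms(2)] assms(2) by simp
qed

lemma inj_mat_mult_left_cancel:
  fixes B :: "'a::field mat"
  assumes B: "B \<in> carrier_mat n d" and inj: "inj_on ((*\<^sub>v) B) (carrier_vec d)"
    and C: "C \<in> carrier_mat d m" and C': "C' \<in> carrier_mat d m" and eq: "B * C = B * C'"
  shows "C = C'"
proof (rule mat_col_eqI)
  fix j assume "j < dim_col C'"
  then have j: "j < m" using C' by simp
  have "B *\<^sub>v col C j = B *\<^sub>v col C' j"
    using col_mult2[OF B C j] col_mult2[OF B C' j] eq by simp
  then show "col C j = col C' j" by (rule inj_onD[OF inj]) (use C C' j in auto)
qed (use C C' in auto)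

lemma mat_factor_through_image:
  fixes B :: "'a::field mat"
  assumes B: "B \<in> carrier_mat n d" and A: "A \<in> carrier_mat n m"
    and image: "\<And>v. v \<in> carrier_vec m \<Longrightarrow> A *\<^sub>v v \<in> (*\<^sub>v) B ` carrier_vec d"
  shows "\<exists>C\<in>carrier_mat d m. B * C = A"
proof -
  have "\<forall>j<m. \<exists>v\<in>carrier_vec d. col A j = B *\<^sub>v v"
    using image col_eq_mult_unit_vec[OF A] by (metis image_iff unit_vec_carrier)
  then obtain c where c: "\<And>j. j < m \<Longrightarrow> c j \<in> carrier_vec d \<and> col A j = B *\<^sub>v c j"
    by metis
  define C where "C = mat_of_cols d (map c [0..<m])"
  have C: "C \<in> carrier_mat d m"
    unfolding C_def using mat_of_cols_carrier(1)[of d "map c [0..<m]"] by simp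
  have "B * C = A"
  proof (rule mat_col_eqI)
    fix j assume "j < dim_col A"
    then have j: "j < m" using A by simp
    show "col (B * C) j = col A j" using col_mult2[OF B C j] c[OF j] j unfolding C_def by simp
  qed (use A B C in auto)
  then show ?thesis using C by blast
qed

lemma dim_eq_0_if_inj_on_carrier_vec_singleton_image:
  fixes f :: "'a::zero_neq_one vec \<Rightarrow> 'b"
  assumes inj: "inj_on f (carrier_vec d)" and image: "f ` carrier_vec d = {c}"
  shows "d = 0"
proof (rule ccontr)
  assume "d \<noteq> 0"
  have "f (unit_vec d 0) = f (0\<^sub>v d)"
    using image by (metis imageI singletonD unit_vec_carrier zero_carrier_vec)
  then have "unit_vec d 0 = 0\<^sub>v d" using inj inj_onD by fastforce
  then show False using \<open>d \<noteq> 0\<close> by simp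
qed

lemma cmp_Hom: "is_kcat R \<Longrightarrow> a \<in> Hom R x y \<Longrightarrow> b \<in> Hom R y z \<Longrightarrow> cmp R x y z b a \<in> Hom R x z"
  by (simp add: is_kcat_def)

lemma idn_Hom: "is_kcat R \<Longrightarrow> idn R x \<in> Hom R x x"
  by (simp add: is_kcat_def)

lemma mact_carrier: "in_Mod R X \<Longrightarrow> a \<in> Hom R x y \<Longrightarrow> mact X x y a \<in> carrier_mat (mdim X x) (mdim X y)"
  unfolding in_Mod_def by blast

lemma mact_add:
  "in_Mod R X \<Longrightarrow> a \<in> Hom R x y \<Longrightarrow> a' \<in> Hom R x y \<Longrightarrow> mact X x y (a + a') = mact X x y a + mact X x y a'"
  unfolding in_Mod_def by blast

lemma mact_smult: "in_Mod R X \<Longrightarrow> a \<in> Hom R x y \<Longrightarrow> mact X x y (c \<cdot>\<^sub>v a) = c \<cdot>\<^sub>m mact X x y a"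
  unfolding in_Mod_def by blast

lemma mact_idn: "in_Mod R X \<Longrightarrow> mact X x x (idn R x) = 1\<^sub>m (mdim X x)"
  unfolding in_Mod_def by blast

lemma mact_cmp:
  "in_Mod R X \<Longrightarrow> a \<in> Hom R x y \<Longrightarrow> b \<in> Hom R y z \<Longrightarrow>
    mact X x z (cmp R x y z b a) = mact X x y a * mact X y z b"
  unfolding in_Mod_def by blast

lemma is_hom_carrier: "is_hom R X Y f \<Longrightarrow> f x \<in> carrier_mat (mdim Y x) (mdim X x)"
  unfolding is_hom_def by blast

lemma is_hom_commute:
  "is_hom R X Y f \<Longrightarrow> a \<in> Hom R x y \<Longrightarrow> f x * mact X x y a = mact Y x y a * f y"
  unfolding is_hom_def by blast

lemma mact_eq_0_if_hdim_eq_0: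
  assumes X: "in_Mod R X" and a: "a \<in> Hom R x y" and "hdim R x y = 0"
  shows "mact X x y a = 0\<^sub>m (mdim X x) (mdim X y)"
proof -
  have "a = 0 \<cdot>\<^sub>v a" using a assms(3) unfolding Hom_def by (intro eq_vecI) auto
  then have "mact X x y a = 0 \<cdot>\<^sub>m mact X x y a" using mact_smult[OF X a, of 0] by simp
  also have "\<dots> = 0\<^sub>m (mdim X x) (mdim X y)" using mact_carrier[OF X a] by (intro eq_matI) auto
  finally show ?thesis .
qed

lemma in_Mod_if_inj_hom:
  fixes L X :: "('o,'k::field) rmod"
  assumes R: "is_kcat R" and X: "in_Mod R X" and \<iota>_hom: "is_hom R L X \<iota>"
    and inj: "\<And>z. inj_on ((*\<^sub>v) (\<iota> z)) (carrier_vec (mdim L z))"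
    and L: "\<And>x y a. a \<in> Hom R x y \<Longrightarrow> mact L x y a \<in> carrier_mat (mdim L x) (mdim L y)"
  shows "in_Mod R L"
proof -
  note \<iota> = is_hom_carrier[OF \<iota>_hom] and nat = is_hom_commute[OF \<iota>_hom]
  have unique: "mact L x y a = C" if a: "a \<in> Hom R x y"
    and eq: "\<iota> x * C = mact X x y a * \<iota> y" and C: "C \<in> carrier_mat (mdim L x) (mdim L y)"
    for x y a C
    using inj_mat_mult_left_cancel[OF \<iota> inj L[OF a] C] nat[OF a] eq by simp
  show ?thesis
    unfolding in_Mod_def
  proof (intro conjI allI impI)
    fix x y a a' assume a: "a \<in> Hom R x y" and a': "a' \<in> Hom R x y"
    have "\<iota> x * (mact L x y a + mact L x y a') = (mact X x y a + mact X x y a') * \<iota> y"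
      using mult_add_distrib_mat[OF \<iota> L[OF a] L[OF a']] nat[OF a] nat[OF a']
        add_mult_distrib_mat[OF mact_carrier[OF X a] mact_carrier[OF X a'] \<iota>] by simp
    also have "\<dots> = mact X x y (a + a') * \<iota> y" using mact_add[OF X a a'] by simp
    finally show "mact L x y (a + a') = mact L x y a + mact L x y a'"
      by (rule unique[rotated]) (use a a' L in \<open>auto simp: Hom_def\<close>)
  next
    fix x y a c assume a: "a \<in> Hom R x y"
    have "\<iota> x * (c \<cdot>\<^sub>m mact L x y a) = (c \<cdot>\<^sub>m mact X x y a) * \<iota> y"
      using mult_smult_distrib[OF \<iota> L[OF a]] nat[OF a]
        mult_smult_assoc_mat[OF mact_carrier[OF X a] \<iota>] by simp
    also have "\<dots> = mact X x y (c \<cdot>\<^sub>v a) * \<iota> y" using mact_smult[OF X a] by simp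
    finally show "mact L x y (c \<cdot>\<^sub>v a) = c \<cdot>\<^sub>m mact L x y a"
      by (rule unique[rotated]) (use a L in \<open>auto simp: Hom_def\<close>)
  next
    fix x
    have "\<iota> x * 1\<^sub>m (mdim L x) = mact X x x (idn R x) * \<iota> x" using \<iota>[of x] mact_idn[OF X] by simp
    then show "mact L x x (idn R x) = 1\<^sub>m (mdim L x)" by (rule unique[OF idn_Hom[OF R]]) simp
  next
    fix x y z a b assume a: "a \<in> Hom R x y" and b: "b \<in> Hom R y z"
    have "\<iota> x * (mact L x y a * mact L y z b) = mact X x y a * (\<iota> y * mact L y z b)"
      using assoc_mult_mat[OF \<iota> L[OF a] L[OF b]] nat[OF a]
        assoc_mult_mat[OF mact_carrier[OF X a] \<iota> L[OF b]] by simp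
    also have "\<dots> = mact X x z (cmp R x y z b a) * \<iota> z"
      using nat[OF b] assoc_mult_mat[OF mact_carrier[OF X a] mact_carrier[OF X b] \<iota>]
        mact_cmp[OF X a b] by simp
    finally show "mact L x z (cmp R x y z b a) = mact L x y a * mact L y z b"
      by (rule unique[OF cmp_Hom[OF R a b]]) (use L[OF a] L[OF b] in auto)
  qed (use L in auto)
qed

lemma ex_module_on_stable_images:
  fixes X :: "('o,'k::field) rmod" and \<iota> :: "'o \<Rightarrow> 'k mat"
  assumes R: "is_kcat R" and X: "in_Mod R X"
    and \<iota>: "\<And>z. \<iota> z \<in> carrier_mat (mdim X z) (d z)"
    and inj: "\<And>z. inj_on ((*\<^sub>v) (\<iota> z)) (carrier_vec (d z))"
    and stable: "\<And>z y a v. a \<in> Hom R z y \<Longrightarrow> v \<in> carrier_vec (d y) \<Longrightarrow>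
       mact X z y a *\<^sub>v (\<iota> y *\<^sub>v v) \<in> (*\<^sub>v) (\<iota> z) ` carrier_vec (d z)"
  shows "\<exists>L. mdim L = d \<and> in_Mod R L \<and> is_hom R L X \<iota>"
proof -
  define act where
    "act z y a = (SOME C. C \<in> carrier_mat (d z) (d y) \<and> \<iota> z * C = mact X z y a * \<iota> y)" for z y a
  have act: "act z y a \<in> carrier_mat (d z) (d y) \<and> \<iota> z * act z y a = mact X z y a * \<iota> y"
    if a: "a \<in> Hom R z y" for z y a
  proof -
    have "\<exists>C\<in>carrier_mat (d z) (d y). \<iota> z * C = mact X z y a * \<iota> y"
      by (rule mat_factor_through_image[OF \<iota>])
        (use mact_carrier[OF X a] \<iota> assoc_mult_mat_vec[OF mact_carrier[OF X a] \<iota>] stable[OF a]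
          in auto)
    then show ?thesis unfolding act_def by (rule someI2_bex) auto
  qed
  define L where "L = \<lparr>mdim = d, mact = act\<rparr>"
  have "is_hom R L X \<iota>" unfolding is_hom_def L_def using \<iota> act by simp
  moreover have "in_Mod R L"
    by (rule in_Mod_if_inj_hom[OF R X \<open>is_hom R L X \<iota>\<close>]) (use inj act in \<open>auto simp: L_def\<close>)
  ultimately show ?thesis by (intro exI[of _ L]) (simp add: L_def)
qed

lemma ex_submodule_of_stable_subspaces:
  fixes X :: "('o,'k::field) rmod" and W :: "'o \<Rightarrow> 'k vec set"
  assumes R: "is_kcat R" and X: "in_Mod R X"
    and sub: "\<And>z. W z \<subseteq> carrier_vec (mdim X z)" "\<And>z. 0\<^sub>v (mdim X z) \<in> W z"
      "\<And>z u w. u \<in> W z \<Longrightarrow> w \<in> W z \<Longrightarrow> u + w \<in> W z"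
      "\<And>z c w. w \<in> W z \<Longrightarrow> c \<cdot>\<^sub>v w \<in> W z"
    and stable: "\<And>z y a w. a \<in> Hom R z y \<Longrightarrow> w \<in> W y \<Longrightarrow> mact X z y a *\<^sub>v w \<in> W z"
  shows "\<exists>L \<iota>. in_Mod R L \<and> is_hom R L X \<iota> \<and>
     (\<forall>z. W z = {0\<^sub>v (mdim X z)} \<longrightarrow> mdim L z = 0) \<and>
     (\<forall>z. W z = carrier_vec (mdim X z) \<longrightarrow> \<iota> z = 1\<^sub>m (mdim X z))"
proof -
  have "\<exists>d B. B \<in> carrier_mat (mdim X z) d \<and> inj_on ((*\<^sub>v) B) (carrier_vec d) \<and>
      W z = (*\<^sub>v) B ` carrier_vec d \<and> (W z = carrier_vec (mdim X z) \<longrightarrow> B = 1\<^sub>m (mdim X z))" for z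
  proof (cases "W z = carrier_vec (mdim X z)")
    case True
    let ?I = "1\<^sub>m (mdim X z) :: 'k mat"
    have "(*\<^sub>v) ?I ` carrier_vec (mdim X z) = id ` carrier_vec (mdim X z)"
      by (rule image_cong) auto
    moreover have "inj_on ((*\<^sub>v) ?I) (carrier_vec (mdim X z))" by (simp add: inj_on_def)
    ultimately show ?thesis
      using True by (intro exI[of _ "mdim X z"] exI[of _ "1\<^sub>m (mdim X z)"]) auto
  next
    case False
    then show ?thesis using subspace_eq_image_inj_mat[of "W z" "mdim X z"] sub by blast
  qed
  then obtain d \<iota> where \<iota>: "\<And>z. \<iota> z \<in> carrier_mat (mdim X z) (d z)"
    and inj: "\<And>z. inj_on ((*\<^sub>v) (\<iota> z)) (carrier_vec (d z))"
    and W: "\<And>z. W z = (*\<^sub>v) (\<iota> z) ` carrier_vec (d z)"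
    and full: "\<And>z. W z = carrier_vec (mdim X z) \<Longrightarrow> \<iota> z = 1\<^sub>m (mdim X z)"
    by metis
  obtain L where "mdim L = d" "in_Mod R L" "is_hom R L X \<iota>"
    using ex_module_on_stable_images[OF R X \<iota> inj] stable W by (metis image_eqI)
  moreover have "d z = 0" if "W z = {0\<^sub>v (mdim X z)}" for z
    using dim_eq_0_if_inj_on_carrier_vec_singleton_image[OF inj] W that by metis
  ultimately show ?thesis using full by blast
qed

inductive_set generated_subspace ::
    "('o,'k::field) kcat \<Rightarrow> ('o,'k) rmod \<Rightarrow> 'o set \<Rightarrow> 'o \<Rightarrow> 'k vec set"
  for R X T z where
  zero: "0\<^sub>v (mdim X z) \<in> generated_subspace R X T z"
| act: "x \<in> T \<Longrightarrow> a \<in> Hom R z x \<Longrightarrow> u \<in> carrier_vec (mdim X x) \<Longrightarrow>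
    mact X z x a *\<^sub>v u \<in> generated_subspace R X T z"
| add: "v \<in> generated_subspace R X T z \<Longrightarrow> w \<in> generated_subspace R X T z \<Longrightarrow>
    v + w \<in> generated_subspace R X T z"

lemma generated_subspace_carrier:
  fixes X :: "('o,'k::field) rmod"
  assumes X: "in_Mod R X" and "v \<in> generated_subspace R X T z"
  shows "v \<in> carrier_vec (mdim X z)"
  using assms(2) by induct (auto dest: mact_carrier[OF X])

lemma generated_subspace_smult:
  fixes X :: "('o,'k::field) rmod"
  assumes X: "in_Mod R X" and "v \<in> generated_subspace R X T z"
  shows "c \<cdot>\<^sub>v v \<in> generated_subspace R X T z"
  using assms(2)
proof induct
  case zero
  have "c \<cdot>\<^sub>v 0\<^sub>v (mdim X z) = 0\<^sub>v (mdim X z)" by (intro eq_vecI) auto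
  then show ?case using generated_subspace.zero by metis
next
  case (act x a u)
  have "c \<cdot>\<^sub>v (mact X z x a *\<^sub>v u) = mact X z x a *\<^sub>v (c \<cdot>\<^sub>v u)"
    using mult_mat_vec[OF mact_carrier[OF X act(2)] act(3)] by simp
  then show ?case using generated_subspace.act[OF act(1,2)] act(3) by simp
next
  case (add v w)
  have "c \<cdot>\<^sub>v (v + w) = c \<cdot>\<^sub>v v + c \<cdot>\<^sub>v w"
    using generated_subspace_carrier[OF X add(1)] generated_subspace_carrier[OF X add(3)]
    by (simp add: smult_add_distrib_vec)
  then show ?case using generated_subspace.add add by simp
qed

lemma generated_subspace_mact:
  fixes X :: "('o,'k::field) rmod"
  assumes R: "is_kcat R" and X: "in_Mod R X" and b: "b \<in> Hom R z' z"
    and "v \<in> generated_subspace R X T z"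
  shows "mact X z' z b *\<^sub>v v \<in> generated_subspace R X T z'"
  using assms(4)
proof induct
  case zero
  have "mact X z' z b *\<^sub>v 0\<^sub>v (mdim X z) = 0\<^sub>v (mdim X z')"
    using mact_carrier[OF X b] by (intro eq_vecI) auto
  then show ?case using generated_subspace.zero by metis
next
  case (act x a u)
  have "mact X z' z b *\<^sub>v (mact X z x a *\<^sub>v u) = mact X z' x (cmp R z' z x a b) *\<^sub>v u"
    using assoc_mult_mat_vec[OF mact_carrier[OF X b] mact_carrier[OF X act(2)] act(3)]
      mact_cmp[OF X b act(2)] by simp
  then show ?case using generated_subspace.act[OF act(1) cmp_Hom[OF R b act(2)] act(3)] by simp
next
  case (add v w)
  then show ?case
    using generated_subspace_carrier[OF X add(1)] generated_subspace_carrier[OF X add(3)]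
      mact_carrier[OF X b]
    by (simp add: mult_add_distrib_mat_vec generated_subspace.add)
qed

lemma generated_subspace_eq_carrier:
  fixes X :: "('o,'k::field) rmod"
  assumes R: "is_kcat R" and X: "in_Mod R X" and "z \<in> T"
  shows "generated_subspace R X T z = carrier_vec (mdim X z)"
proof
  show "generated_subspace R X T z \<subseteq> carrier_vec (mdim X z)"
    using generated_subspace_carrier[OF X] by blast
  show "carrier_vec (mdim X z) \<subseteq> generated_subspace R X T z"
  proof
    fix u :: "'k vec" assume u: "u \<in> carrier_vec (mdim X z)"
    have "mact X z z (idn R z) *\<^sub>v u = u" using mact_idn[OF X] u by simp
    then show "u \<in> generated_subspace R X T z"
      using generated_subspace.act[OF \<open>z \<in> T\<close> idn_Hom[OF R] u] by simp
  qed
qed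

lemma generated_subspace_eq_zero:
  fixes X :: "('o,'k::field) rmod"
  assumes X: "in_Mod R X" and no_hom: "\<And>x. x \<in> T \<Longrightarrow> hdim R z x = 0"
  shows "generated_subspace R X T z = {0\<^sub>v (mdim X z)}"
proof -
  have "v = 0\<^sub>v (mdim X z)" if "v \<in> generated_subspace R X T z" for v
    using that
  proof induct
    case (act x a u)
    then show ?case using mact_eq_0_if_hdim_eq_0[OF X act(2) no_hom] by (intro eq_vecI) auto
  qed auto
  then show ?thesis using generated_subspace.zero by auto
qed

lemma is_hom_extend_by_zero:
  assumes X: "in_Mod R X" and M: "in_Mod R M" and L: "in_Mod R L"
    and \<iota>: "is_hom R L X \<iota>" and \<iota>_T: "\<And>x. x \<in> T \<Longrightarrow> \<iota> x = 1\<^sub>m (mdim X x)"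
    and h: "is_hom R L M h"
    and supp: "\<And>x. mdim M x \<noteq> 0 \<Longrightarrow> x \<in> T"
    and closed: "\<And>x y. mdim M x \<noteq> 0 \<Longrightarrow> hdim R x y \<noteq> 0 \<Longrightarrow> y \<in> T"
  shows "is_hom R X M (\<lambda>x. if x \<in> T then h x else 0\<^sub>m (mdim M x) (mdim X x))"
    (is "is_hom R X M ?\<beta>")
proof -
  have dim_L: "mdim L x = mdim X x" if "x \<in> T" for x
    using is_hom_carrier[OF \<iota>, of x] \<iota>_T[OF that] by (metis carrier_matD(2) index_one_mat(3))
  have mact_L: "mact L x y a = mact X x y a" if "x \<in> T" "y \<in> T" "a \<in> Hom R x y" for x y a
    using is_hom_commute[OF \<iota> that(3)] that \<iota>_T mact_carrier[OF L that(3)] mact_carrier[OF X that(3)]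
      dim_L by simp
  have \<beta>: "?\<beta> x \<in> carrier_mat (mdim M x) (mdim X x)" for x
  proof (cases "x \<in> T")
    case True
    then show ?thesis using is_hom_carrier[OF h, of x] dim_L[OF True] by simp
  qed simp
  have "?\<beta> x * mact X x y a = mact M x y a * ?\<beta> y" if a: "a \<in> Hom R x y" for x y a
  proof (cases "mdim M x = 0")
    case True
    then show ?thesis using \<beta>[of x] \<beta>[of y] mact_carrier[OF X a] mact_carrier[OF M a]
      by (intro eq_matI) auto
  next
    case False
    show ?thesis
    proof (cases "hdim R x y = 0")
      case True
      then show ?thesis
        using mact_eq_0_if_hdim_eq_0[OF X a] mact_eq_0_if_hdim_eq_0[OF M a] \<beta>[of x] \<beta>[of y] by simp
    next
      case False
      with \<open>mdim M x \<noteq> 0\<close> have "x \<in> T" "y \<in> T" using supp closed by auto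
      then show ?thesis using is_hom_commute[OF h a] mact_L a by simp
    qed
  qed
  then show ?thesis using \<beta> unfolding is_hom_def by blast
qed

lemma ex_mod_submodule_eq_on:
  fixes X :: "('o,'k::field) rmod"
  assumes R: "is_kcat R" and fin_in: "\<And>x. finite {y. hdim R y x \<noteq> 0}"
    and X: "in_Mod R X" and "finite T"
  shows "\<exists>L \<iota>. in_mod R L \<and> is_hom R L X \<iota> \<and> (\<forall>x\<in>T. \<iota> x = 1\<^sub>m (mdim X x))"
proof -
  have sub: "generated_subspace R X T z \<subseteq> carrier_vec (mdim X z)" for z
    using generated_subspace_carrier[OF X] by blast
  obtain L \<iota> where L: "in_Mod R L" and \<iota>: "is_hom R L X \<iota>"
    and L_zero: "\<And>z. generated_subspace R X T z = {0\<^sub>v (mdim X z)} \<Longrightarrow> mdim L z = 0"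
    and \<iota>_full: "\<And>z. generated_subspace R X T z = carrier_vec (mdim X z) \<Longrightarrow> \<iota> z = 1\<^sub>m (mdim X z)"
    using ex_submodule_of_stable_subspaces[where W = "generated_subspace R X T", OF R X sub
        generated_subspace.zero generated_subspace.add generated_subspace_smult[OF X]
        generated_subspace_mact[OF R X]]
    by blast
  have "mdim L z = 0" if "\<forall>x\<in>T. hdim R z x = 0" for z
    using L_zero[OF generated_subspace_eq_zero[OF X]] that by blast
  then have "{z. mdim L z \<noteq> 0} \<subseteq> (\<Union>x\<in>T. {z. hdim R z x \<noteq> 0})" by fastforce
  then have "finite {z. mdim L z \<noteq> 0}" by (rule finite_subset) (use \<open>finite T\<close> fin_in in auto)
  moreover have "\<forall>x\<in>T. \<iota> x = 1\<^sub>m (mdim X x)"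
    using \<iota>_full generated_subspace_eq_carrier[OF R X] by blast
  ultimately show ?thesis using L \<iota> unfolding in_mod_def by blast
qed

theorem proposition3p6:
  fixes R :: "('o, 'k::field) kcat"
    and X M N :: "('o, 'k) rmod"
    and f \<alpha> :: "'o \<Rightarrow> 'k mat"
  assumes "alg_closed TYPE('k)"
    and "locally_bounded R"
    and "in_Mod R X" and "in_mod R M" and "in_mod R N"
    and "is_hom R M N f" and "is_hom R X N \<alpha>"
    and "\<forall>(L :: ('o, 'k) rmod) \<gamma>. in_mod R L \<longrightarrow> is_hom R L X \<gamma> \<longrightarrow>
           (\<exists>h. is_hom R L M h \<and> (\<forall>x. \<alpha> x * \<gamma> x = f x * h x))"
  shows "\<exists>\<beta>. is_hom R X M \<beta> \<and> (\<forall>x. \<alpha> x = f x * \<beta> x)"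
proof -
  have R: "is_kcat R" and fin_out: "\<And>x. finite {y. hdim R x y \<noteq> 0}"
    and fin_in: "\<And>x. finite {y. hdim R y x \<noteq> 0}"
    using assms(2) unfolding locally_bounded_def by auto
  have X: "in_Mod R X" and M: "in_Mod R M"
    and fin_M: "finite {x. mdim M x \<noteq> 0}" and fin_N: "finite {x. mdim N x \<noteq> 0}"
    using assms(3-5) unfolding in_mod_def by auto
  define T where "T = {x. mdim M x \<noteq> 0} \<union> {x. mdim N x \<noteq> 0} \<union>
    (\<Union>x\<in>{x. mdim M x \<noteq> 0}. {y. hdim R x y \<noteq> 0})"
  have "finite T" unfolding T_def using fin_M fin_N fin_out by auto
  then obtain L \<iota> where L: "in_mod R L" and \<iota>: "is_hom R L X \<iota>"
    and \<iota>_T: "\<And>x. x \<in> T \<Longrightarrow> \<iota> x = 1\<^sub>m (mdim X x)"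
    using ex_mod_submodule_eq_on[OF R fin_in X] by blast
  then obtain h where h: "is_hom R L M h" and \<alpha>_eq: "\<And>x. \<alpha> x * \<iota> x = f x * h x"
    using assms(8) by blast
  define \<beta> where "\<beta> x = (if x \<in> T then h x else 0\<^sub>m (mdim M x) (mdim X x))" for x
  have "in_Mod R L" using L unfolding in_mod_def by blast
  then have \<beta>_hom: "is_hom R X M \<beta>"
    unfolding \<beta>_def by (rule is_hom_extend_by_zero[OF X M _ \<iota> \<iota>_T h]) (auto simp: T_def)
  moreover have "\<alpha> x = f x * \<beta> x" for x
  proof (cases "x \<in> T")
    case True
    then show ?thesis
      using is_hom_carrier[OF assms(7), of x] \<alpha>_eq[of x] \<iota>_T[OF True] unfolding \<beta>_def by simp
  next
    case False
    then have "mdim N x = 0" unfolding T_def by auto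
    then show ?thesis
      using is_hom_carrier[OF assms(7), of x] is_hom_carrier[OF assms(6), of x]
        is_hom_carrier[OF \<beta>_hom, of x]
      by (intro eq_matI) auto
  qed
  ultimately show ?thesis by blast
qed

end
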